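(* Let $G$ be a finite connected graph containing a bridge $e=\{a,b\}$, and let $G_1\ni a$ and $G_2\ni b$ be the two connected components of the graph obtained by removing $e$ from $G$. If $G$ has a nonnegative curvature (a vector $w\in\mathbb{R}^{|V(G)|}_{\geq 0}$ with $D_Gw=|V(G)|\cdot\mathbf{1}$), then each $G_i$ has a nonnegative curvature (a vector $w_i'\in\mathbb{R}^{|V(G_i)|}_{\geq 0}$ with $D_iw_i'=|V(G_i)|\cdot\mathbf{1}$, $D_i$ the distance matrix of $G_i$). If moreover $G$ has a constant curvature, then $G_1$ has a curvature that is constant on $V(G_1)\setminus\{a\}$ and $G_2$ has a curvature that is constant on $V(G_2)\setminus\{b\}$.
   Context: A bridge is an edge whose removal disconnects the graph. For a finite connected graph with vertices $v_1,\dots,v_m$, the distance matrix is $D_{ij}=d(v_i,v_j)$ (shortest-path distance), $\mathbf{1}$ is the all-ones vector, and a curvature is a vector $w\in\mathbb{R}^m$, viewed as a function on vertices, with $Dw=m\cdot\mathbf{1}$; constant curvature means some constant vector is a curvature.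
   Formalization: Each conclusion about G_i is asserted only when G_i has at least two vertices; for a one-vertex G_i the distance matrix is (0) and no curvature exists (e.g. G = K_2 with w = (2,2)), so the claim as worded fails there. *)

theory Defs
  imports "Graph_Theory.Graph_Theory"
begin

text \<open>
  Finite simple graphs are the library's \<^locale>\<open>graph\<close>: finite loop-free symmetric digraphs
  without parallel arcs. An undirected edge $\{u, v\}$ is therefore a pair of opposite arcs, and
  both must be deleted to remove the edge. In a symmetric digraph the strongly connected
  components \<^const>\<open>pre_digraph.sccs\<close> are the connected components.
\<close>

definition remove_edge :: "('a, 'b) pre_digraph \<Rightarrow> 'a \<Rightarrow> 'a \<Rightarrow> ('a, 'b) pre_digraph" where
  "remove_edge G a b = G\<lparr>arcs := {e \<in> arcs G. {tail G e, head G e} \<noteq> {a, b}}\<rparr>"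

definition is_bridge :: "('a, 'b) pre_digraph \<Rightarrow> 'a \<Rightarrow> 'a \<Rightarrow> bool" where
  "is_bridge G a b \<longleftrightarrow> a \<rightarrow>\<^bsub>G\<^esub> b \<and> \<not> connected (remove_edge G a b)"

text \<open>
  The function \<^const>\<open>wf_digraph.\<mu>\<close> is the least cost of a walk, valued in the extended reals; with
  unit costs it is the shortest-path distance. It is finite between any two vertices of a connected
  graph, and the value of \<^const>\<open>real_of_ereal\<close> at infinity plays no role there.
\<close>

definition gdist :: "('a, 'b) pre_digraph \<Rightarrow> 'a \<Rightarrow> 'a \<Rightarrow> real" where
  "gdist G u v = real_of_ereal (wf_digraph.\<mu> G (\<lambda>_. 1) u v)"

text \<open>
  The equation $D w = m \cdot \mathbf{1}$, with rows and columns of $D$ indexed by the vertices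
  themselves; values of \<open>w\<close> outside the vertex set are irrelevant.
\<close>

definition is_curvature :: "('a, 'b) pre_digraph \<Rightarrow> ('a \<Rightarrow> real) \<Rightarrow> bool" where
  "is_curvature G w \<longleftrightarrow>
     (\<forall>v\<in>verts G. (\<Sum>u\<in>verts G. gdist G v u * w u) = real (card (verts G)))"

definition has_nonneg_curvature :: "('a, 'b) pre_digraph \<Rightarrow> bool" where
  "has_nonneg_curvature G \<longleftrightarrow> (\<exists>w. is_curvature G w \<and> (\<forall>v\<in>verts G. 0 \<le> w v))"

definition has_constant_curvature :: "('a, 'b) pre_digraph \<Rightarrow> bool" where
  "has_constant_curvature G \<longleftrightarrow> (\<exists>c. is_curvature G (\<lambda>_. c))"

definition has_curvature_constant_off :: "('a, 'b) pre_digraph \<Rightarrow> 'a \<Rightarrow> bool" where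
  "has_curvature_constant_off G a \<longleftrightarrow>
     (\<exists>w c. is_curvature G w \<and> (\<forall>v\<in>verts G - {a}. w v = c))"

text \<open>
  The distance matrix of the one-vertex graph is $(0)$, so this graph has no curvature at all.
  A component consisting of a single vertex (a pendant bridge) must therefore be excluded
  whenever a curvature of that component is asserted.
\<close>

lemma (in wf_digraph) gdist_self:
  assumes "v \<in> verts G"
  shows "gdist G v v = 0"
proof -
  have "\<mu> (\<lambda>_. 1) v v \<le> 0"
    using min_cost_le_walk_cost[of v "[]" v "\<lambda>_. 1"] assms
    by (simp add: awalk_Nil_iff zero_ereal_def)
  moreover have "0 \<le> \<mu> (\<lambda>_. 1) v v"
    unfolding \<mu>_def
    by (intro INF_greatest) (auto simp: zero_ereal_def intro: pos_cost_pos_awalk_cost)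
  ultimately show ?thesis
    by (simp add: gdist_def)
qed

lemma (in wf_digraph) not_is_curvature_singleton:
  assumes "verts G = {v}"
  shows "\<not> is_curvature G w"
  using assms by (simp add: is_curvature_def gdist_self)

end

theory Submission
  imports Defs
begin

text \<open>
  Write $d_i$ for the distances in $G_i$ and $V_i$ for its vertices. Every walk between the two
  sides passes through the bridge, so $d_G = d_i$ on $V_i$ and $d_G(v, u) = d_1(v, a) + 1 + d_2(b, u)$
  for $v \in V_1$, $u \in V_2$. Let $w \ge 0$ be a curvature of $G$ and let $S_i$, $A$, $B$ be the
  sums of $w$ over $V_i$, of $d_1(a, \cdot) w$ over $V_1$ and of $d_2(b, \cdot) w$ over $V_2$. The
  rows of $v \in V_1$ say that $w' = w + S_2 e_a$ satisfies $D_1 w' = (m - S_2 - B) \mathbf{1}$. The rows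
  of $a$ and $b$ give $A + S_2 + B = m = B + S_1 + A$, so that $S_1 = S_2 > 0$; hence
  $m - S_2 - B = A$ is positive as soon as $G_1$ has a second vertex, and $w'$ can be rescaled to a
  curvature of $G_1$.
\<close>

section \<open>Unit-cost distances\<close>

lemma (in wf_digraph) awalk_cost_unit: "awalk_cost (\<lambda>_. 1) p = real (length p)"
  by (induction p) auto

lemma (in wf_digraph) shortest_awalk:
  assumes "u \<rightarrow>\<^sup>* v"
  shows "\<exists>p. awalk u p v \<and> gdist G u v = real (length p) \<and>
    (\<forall>q. awalk u q v \<longrightarrow> length p \<le> length q)"
proof -
  have "\<exists>p. awalk u p v"
    using assms by (simp add: reachable_awalk)
  then obtain p where p: "awalk u p v" and min: "\<forall>q. awalk u q v \<longrightarrow> length p \<le> length q"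
    using ex_has_least_nat[of "\<lambda>p. awalk u p v" _ length] by blast
  have "\<mu> (\<lambda>_. 1) u v = ereal (real (length p))"
    unfolding \<mu>_def awalk_cost_unit
    by (rule INF_eqI) (use p min in auto)
  then have "gdist G u v = real (length p)"
    by (simp add: gdist_def)
  then show ?thesis
    using p min by blast
qed

lemma (in wf_digraph) gdist_le_length:
  assumes "awalk u p v"
  shows "gdist G u v \<le> real (length p)"
  using shortest_awalk[OF reachable_awalkI[OF assms]] assms by auto

lemma (in wf_digraph) gdist_attained:
  assumes "u \<rightarrow>\<^sup>* v"
  obtains p where "awalk u p v" "gdist G u v = real (length p)"
  using shortest_awalk[OF assms] by blast

lemma (in wf_digraph) awalk_potential_le:
  fixes f :: "'a \<Rightarrow> real"
  assumes "awalk u p v" and "\<And>x y. x \<rightarrow>\<^bsub>G\<^esub> y \<Longrightarrow> f y \<le> f x + 1"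
  shows "f v \<le> f u + real (length p)"
  using assms(1)
proof (induction p arbitrary: u)
  case Nil
  then show ?case by (simp add: awalk_Nil_iff)
next
  case (Cons e p)
  then have "e \<in> arcs G" "u = tail G e" "awalk (head G e) p v"
    by (auto simp: awalk_Cons_iff)
  moreover from this have "f (head G e) \<le> f u + 1"
    using assms(2) in_arcs_imp_in_arcs_ends by blast
  ultimately show ?case
    using Cons.IH by fastforce
qed

text \<open>A function that grows by at most 1 along every arc grows along a shortest walk by at
  most its length. Distances are bounded from below by exhibiting such a potential, so that no walk
  has to be cut at the bridge.\<close>

lemma (in wf_digraph) potential_le_gdist:
  fixes f :: "'a \<Rightarrow> real"
  assumes "u \<rightarrow>\<^sup>* v" and "\<And>x y. x \<rightarrow>\<^bsub>G\<^esub> y \<Longrightarrow> f y \<le> f x + 1"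
  shows "f v \<le> f u + gdist G u v"
proof -
  obtain p where "awalk u p v" "gdist G u v = real (length p)"
    using assms(1) by (rule gdist_attained)
  then show ?thesis
    using awalk_potential_le assms(2) by metis
qed

lemma (in wf_digraph) gdist_nonneg:
  assumes "u \<rightarrow>\<^sup>* v"
  shows "0 \<le> gdist G u v"
  using potential_le_gdist[OF assms, of "\<lambda>_. 0"] by simp

lemma (in wf_digraph) gdist_pos:
  assumes "u \<rightarrow>\<^sup>* v" "u \<noteq> v"
  shows "0 < gdist G u v"
proof -
  \<comment> \<open>The indicator of the vertices other than \<open>u\<close> is a potential, and it
    separates \<open>u\<close> from \<open>v\<close> by 1.\<close>
  define f :: "'a \<Rightarrow> real" where "f x = (if x = u then 0 else 1)" for x
  have "f v \<le> f u + gdist G u v"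
    using assms(1) by (rule potential_le_gdist) (simp add: f_def)
  then show ?thesis
    using assms(2) by (simp add: f_def)
qed

text \<open>An arc appended to a shortest walk gives a walk one longer. Thus
  \<open>gdist G u\<close> can itself serve as the potential in
  \<open>potential_le_gdist\<close>.\<close>

lemma (in wf_digraph) gdist_dominates:
  assumes "u \<rightarrow>\<^sup>* x" "x \<rightarrow>\<^bsub>G\<^esub> y"
  shows "gdist G u y \<le> gdist G u x + 1"
proof -
  obtain p where p: "awalk u p x" "gdist G u x = real (length p)"
    using assms(1) by (rule gdist_attained)
  obtain e where "e \<in> arcs G" "tail G e = x" "head G e = y"
    using assms(2) by auto
  then have "awalk x [e] y"
    using arc_implies_awalk by metis
  with p(1) have "awalk u (p @ [e]) y"
    by (rule awalk_appendI)
  from gdist_le_length[OF this] show ?thesis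
    using p(2) by simp
qed

lemma (in wf_digraph) strongly_connected_gdist_triangle:
  assumes "strongly_connected G" "u \<in> verts G" "v \<in> verts G" "x \<in> verts G"
  shows "gdist G u v \<le> gdist G u x + gdist G x v"
proof (rule potential_le_gdist)
  show "x \<rightarrow>\<^sup>* v"
    using assms by blast
  show "gdist G u z \<le> gdist G u y + 1" if "y \<rightarrow>\<^bsub>G\<^esub> z" for y z
    using assms that by (intro gdist_dominates) (auto dest: adj_in_verts)
qed

section \<open>Two graphs joined by a bridge\<close>

text \<open>The situation after the removal of the bridge, stated symmetrically in the two sides.
  The graphs are linked through adjacency alone, since adjacency determines the unit-cost
  distances.\<close>

locale bridge_join =
  fixes G G1 G2 :: "('a, 'b) pre_digraph" and a b :: 'a
  assumes wf: "wf_digraph G" "wf_digraph G1" "wf_digraph G2"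
    and finite_verts: "finite (verts G)"
    and strongly_connected: "strongly_connected G1" "strongly_connected G2"
    and verts_eq: "verts G = verts G1 \<union> verts G2"
    and verts_disjoint: "verts G1 \<inter> verts G2 = {}"
    and a_in: "a \<in> verts G1" and b_in: "b \<in> verts G2"
    and dominates_iff: "u \<rightarrow>\<^bsub>G\<^esub> v \<longleftrightarrow>
      u \<rightarrow>\<^bsub>G1\<^esub> v \<or> u \<rightarrow>\<^bsub>G2\<^esub> v \<or> (u, v) = (a, b) \<or> (u, v) = (b, a)"
begin

text \<open>Thanks to this symmetry, facts are proved for \<open>G1\<close> and carried over to
  \<open>G2\<close>.\<close>

lemma swap: "bridge_join G G2 G1 b a"
  by (rule bridge_join.intro)
    (use wf finite_verts strongly_connected verts_eq verts_disjoint a_in b_in dominates_iff in auto)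

sublocale G: wf_digraph G by (rule wf)
sublocale G1: wf_digraph G1 by (rule wf)
sublocale G2: wf_digraph G2 by (rule wf)

section \<open>Distances within and across the two sides\<close>

lemma reachable_left: "u \<rightarrow>\<^sup>*\<^bsub>G1\<^esub> v \<Longrightarrow> u \<rightarrow>\<^sup>*\<^bsub>G\<^esub> v"
proof (induction rule: G1.reachable_induct)
  case base
  then show ?case using verts_eq by simp
next
  case (step x y)
  then show ?case using dominates_iff by (metis G.reachable_adj_trans)
qed

lemma gdist_left:
  assumes "v \<in> verts G1" "u \<in> verts G1"
  shows "gdist G v u = gdist G1 v u"
proof (rule antisym)
  have reach: "v \<rightarrow>\<^sup>*\<^bsub>G1\<^esub> x" if "x \<in> verts G1" for x
    using that assms strongly_connected by blast
  \<comment> \<open>Arcs of \<open>G1\<close> are arcs of \<open>G\<close>, so the distance from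
    \<open>v\<close> in \<open>G\<close> is a potential on \<open>G1\<close>.\<close>
  have "gdist G v y \<le> gdist G v x + 1" if "x \<rightarrow>\<^bsub>G1\<^esub> y" for x y
    using that dominates_iff reachable_left reach
    by (intro G.gdist_dominates) (auto dest: G1.adj_in_verts)
  then have "gdist G v u \<le> gdist G v v + gdist G1 v u"
    by (intro G1.potential_le_gdist) (use reach assms in auto)
  then show "gdist G v u \<le> gdist G1 v u"
    using assms verts_eq by (simp add: G.gdist_self)
  \<comment> \<open>Contracting all of \<open>G2\<close> to \<open>a\<close> does not lengthen walks.\<close>
  define f where "f x = gdist G1 v (if x \<in> verts G1 then x else a)" for x
  have "f y \<le> f x + 1" if "x \<rightarrow>\<^bsub>G\<^esub> y" for x y
    using that unfolding dominates_iff
  proof (elim disjE)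
    assume "x \<rightarrow>\<^bsub>G1\<^esub> y"
    then show ?thesis
      using G1.gdist_dominates[of v x y] reach by (auto simp: f_def dest: G1.adj_in_verts)
  next
    assume "x \<rightarrow>\<^bsub>G2\<^esub> y"
    then have "x \<in> verts G2" "y \<in> verts G2"
      by (auto dest: G2.adj_in_verts)
    then show ?thesis
      using verts_disjoint by (auto simp: f_def)
  qed (use a_in b_in verts_disjoint in \<open>auto simp: f_def\<close>)
  then have "f u \<le> f v + gdist G v u"
    by (intro G.potential_le_gdist) (use reach reachable_left assms in auto)
  then show "gdist G1 v u \<le> gdist G v u"
    using assms by (simp add: f_def G1.gdist_self)
qed

lemma gdist_right:
  assumes "v \<in> verts G2" "u \<in> verts G2"
  shows "gdist G v u = gdist G2 v u"
  using bridge_join.gdist_left[OF swap] assms .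

lemma reachable_right: "u \<rightarrow>\<^sup>*\<^bsub>G2\<^esub> v \<Longrightarrow> u \<rightarrow>\<^sup>*\<^bsub>G\<^esub> v"
  using bridge_join.reachable_left[OF swap] .

lemma reachable_across:
  assumes "v \<in> verts G1" "u \<in> verts G2"
  shows "v \<rightarrow>\<^sup>*\<^bsub>G\<^esub> u"
proof -
  have "v \<rightarrow>\<^sup>*\<^bsub>G\<^esub> a"
    using assms a_in strongly_connected(1) by (simp add: reachable_left strongly_connected_def)
  also have "a \<rightarrow>\<^bsub>G\<^esub> b"
    by (simp add: dominates_iff)
  also have "b \<rightarrow>\<^sup>*\<^bsub>G\<^esub> u"
    using assms b_in strongly_connected(2) by (simp add: reachable_right strongly_connected_def)
  finally show ?thesis .
qed

lemma strongly_connected_join: "strongly_connected G"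
proof (rule strongly_connectedI)
  show "verts G \<noteq> {}"
    using verts_eq a_in by blast
  show "u \<rightarrow>\<^sup>*\<^bsub>G\<^esub> v" if "u \<in> verts G" "v \<in> verts G" for u v
    using that unfolding verts_eq
  proof (elim UnE)
    assume "u \<in> verts G1" "v \<in> verts G1"
    then show ?thesis
      using reachable_left strongly_connected(1) by (simp add: strongly_connected_def)
  next
    assume "u \<in> verts G2" "v \<in> verts G2"
    then show ?thesis
      using reachable_right strongly_connected(2) by (simp add: strongly_connected_def)
  qed (rule reachable_across bridge_join.reachable_across[OF swap]; assumption)+
qed

lemma gdist_across:
  assumes "v \<in> verts G1" "u \<in> verts G2"
  shows "gdist G v u = gdist G1 v a + 1 + gdist G2 b u"
proof (rule antisym)
  \<comment> \<open>Upper bound: go from \<open>v\<close> to \<open>a\<close>, cross the bridge and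
    continue from \<open>b\<close> to \<open>u\<close>.\<close>
  have "a \<rightarrow>\<^bsub>G\<^esub> b"
    by (simp add: dominates_iff)
  moreover have "v \<rightarrow>\<^sup>*\<^bsub>G\<^esub> a"
    using assms a_in strongly_connected(1) by (simp add: reachable_left strongly_connected_def)
  ultimately have "gdist G v b \<le> gdist G v a + 1"
    by (intro G.gdist_dominates)
  moreover have "gdist G v u \<le> gdist G v b + gdist G b u"
    using assms b_in verts_eq
    by (intro G.strongly_connected_gdist_triangle strongly_connected_join) auto
  ultimately show "gdist G v u \<le> gdist G1 v a + 1 + gdist G2 b u"
    using assms a_in b_in gdist_left gdist_right by simp
  have reach1: "v \<rightarrow>\<^sup>*\<^bsub>G1\<^esub> x" if "x \<in> verts G1" for x
    using that assms strongly_connected by blast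
  have reach2: "b \<rightarrow>\<^sup>*\<^bsub>G2\<^esub> x" if "x \<in> verts G2" for x
    using that b_in strongly_connected by blast
  \<comment> \<open>Lower bound: the claimed distance from \<open>v\<close>, defined on both sides,
    is a potential. It rises by exactly 1 from \<open>a\<close> to \<open>b\<close> and falls from
    \<open>b\<close> to \<open>a\<close>.\<close>
  define f where
    "f x = (if x \<in> verts G1 then gdist G1 v x else gdist G1 v a + 1 + gdist G2 b x)" for x
  have "f y \<le> f x + 1" if "x \<rightarrow>\<^bsub>G\<^esub> y" for x y
    using that unfolding dominates_iff
  proof (elim disjE)
    assume "x \<rightarrow>\<^bsub>G1\<^esub> y"
    then show ?thesis
      using G1.gdist_dominates[of v x y] reach1 by (auto simp: f_def dest: G1.adj_in_verts)
  next
    assume "x \<rightarrow>\<^bsub>G2\<^esub> y"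
    moreover from this have "x \<in> verts G2" "y \<in> verts G2"
      by (auto dest: G2.adj_in_verts)
    ultimately show ?thesis
      using G2.gdist_dominates[of b x y] reach2 verts_disjoint by (auto simp: f_def)
  next
    assume "(x, y) = (a, b)"
    then show ?thesis
      using a_in b_in verts_disjoint by (auto simp: f_def G2.gdist_self)
  next
    assume "(x, y) = (b, a)"
    moreover have "0 \<le> gdist G2 b b"
      using b_in by (simp add: G2.gdist_self)
    ultimately show ?thesis
      using a_in b_in verts_disjoint by (auto simp: f_def)
  qed
  then have "f u \<le> f v + gdist G v u"
    using assms by (intro G.potential_le_gdist reachable_across)
  moreover have "u \<notin> verts G1"
    using assms verts_disjoint by blast
  ultimately show "gdist G1 v a + 1 + gdist G2 b u \<le> gdist G v u"
    using assms by (simp add: f_def G1.gdist_self)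
qed

section \<open>Transfer of curvatures to one side\<close>

lemma row_sum_left:
  fixes w :: "'a \<Rightarrow> real"
  assumes "v \<in> verts G1"
  shows "(\<Sum>u\<in>verts G. gdist G v u * w u) =
    (\<Sum>u\<in>verts G1. gdist G1 v u * w u) + (gdist G1 v a + 1) * sum w (verts G2)
      + (\<Sum>u\<in>verts G2. gdist G2 b u * w u)"
proof -
  have fin: "finite (verts G1)" "finite (verts G2)"
    using finite_verts verts_eq by auto
  have "(\<Sum>u\<in>verts G. gdist G v u * w u) =
      (\<Sum>u\<in>verts G1. gdist G v u * w u) + (\<Sum>u\<in>verts G2. gdist G v u * w u)"
    unfolding verts_eq by (rule sum.union_disjoint[OF fin verts_disjoint])
  \<comment> \<open>The far side depends on \<open>v\<close> only through
    \<open>gdist G1 v a\<close>. Up to a summand independent of \<open>v\<close>, it acts like the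
    total weight of \<open>G2\<close> placed at \<open>a\<close>.\<close>
  also have "\<dots> = (\<Sum>u\<in>verts G1. gdist G1 v u * w u)
      + (\<Sum>u\<in>verts G2. (gdist G1 v a + 1) * w u + gdist G2 b u * w u)"
    using assms by (simp add: gdist_left gdist_across algebra_simps)
  finally show ?thesis
    by (simp add: sum.distrib sum_distrib_left)
qed

text \<open>The curvature is given explicitly because both claims of the theorem are read off from
  it: it is nonnegative since \<open>k\<close> and \<open>w\<close> are, and away from
  \<open>a\<close> it is a multiple of \<open>w\<close>.\<close>

lemma curvature_left:
  assumes curv: "is_curvature G w" and nonneg: "\<And>v. v \<in> verts G \<Longrightarrow> 0 \<le> w v"
    and card: "2 \<le> card (verts G1)"
  obtains k where "0 \<le> k"
    "is_curvature G1 (\<lambda>u. k * (w u + (if u = a then sum w (verts G2) else 0)))"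
proof -
  have fin: "finite (verts G1)" "finite (verts G2)"
    using finite_verts verts_eq by auto
  define m where "m = real (card (verts G))"
  define S1 S2 where "S1 = sum w (verts G1)" and "S2 = sum w (verts G2)"
  define A where "A = (\<Sum>u\<in>verts G1. gdist G1 a u * w u)"
  define B where "B = (\<Sum>u\<in>verts G2. gdist G2 b u * w u)"
  have row: "(\<Sum>u\<in>verts G1. gdist G1 v u * w u) + gdist G1 v a * S2 + S2 + B = m"
    if "v \<in> verts G1" for v
    using row_sum_left[OF that, of w] curv that verts_eq
    by (simp add: is_curvature_def m_def S2_def B_def algebra_simps)
  have row_a: "A + S2 + B = m"
    using row[OF a_in] a_in by (simp add: A_def G1.gdist_self)
  \<comment> \<open>The row of \<open>b\<close>, read with the sides exchanged: \<open>A\<close> and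
    \<open>B\<close> trade places, and \<open>S1\<close> replaces \<open>S2\<close>.\<close>
  have "B + S1 + A = m"
    using bridge_join.row_sum_left[OF swap b_in, of w] curv b_in verts_eq
    by (simp add: is_curvature_def m_def S1_def A_def B_def G2.gdist_self)
  with row_a have S_eq: "S1 = S2" by simp
  have "m > 0"
    using a_in finite_verts verts_eq by (auto simp: m_def card_gt_0_iff)
  have "S2 > 0"
  \<comment> \<open>If \<open>S2\<close> vanished, so would \<open>S1\<close>. Nonnegative weights
    with sum 0 are all 0, which would make the row of \<open>a\<close> equal to 0 instead of
    \<open>m\<close>.\<close>
  proof (rule ccontr)
    assume "\<not> S2 > 0"
    moreover have "S2 \<ge> 0"
      using nonneg verts_eq unfolding S2_def by (intro sum_nonneg) auto
    ultimately have "S1 = 0" "S2 = 0"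
      using S_eq by auto
    then have "\<forall>u\<in>verts G1. w u = 0" "\<forall>u\<in>verts G2. w u = 0"
      using nonneg verts_eq fin by (auto simp: S1_def S2_def sum_nonneg_eq_0_iff)
    then have "A = 0" "B = 0"
      by (simp_all add: A_def B_def)
    with row_a \<open>S2 = 0\<close> \<open>m > 0\<close> show False by simp
  qed
  have "verts G1 \<noteq> {a}"
    using card by auto
  then obtain v where v: "v \<in> verts G1" "v \<noteq> a"
    using a_in by blast
  have "0 < gdist G1 v a"
    using v a_in strongly_connected by (intro G1.gdist_pos) auto
  moreover have "0 \<le> (\<Sum>u\<in>verts G1. gdist G1 v u * w u)"
    using v strongly_connected nonneg verts_eq
    by (intro sum_nonneg mult_nonneg_nonneg G1.gdist_nonneg) auto
  \<comment> \<open>Comparing the rows of \<open>v\<close> and \<open>a\<close> gives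
    \<open>A\<close> as the sum of \<open>gdist G1 v u * w u\<close> over \<open>G1\<close> plus
    \<open>gdist G1 v a * S2\<close>. The last term is positive.\<close>
  ultimately have "A > 0"
    using row[OF v(1)] row_a \<open>S2 > 0\<close> by (smt (verit) mult_pos_pos)
  show ?thesis
  proof
    \<comment> \<open>Before scaling, every row on \<open>G1\<close> has the value
      \<open>m - S2 - B\<close>, which is \<open>A\<close> by \<open>row_a\<close>.\<close>
    let ?k = "real (card (verts G1)) / A"
    show "0 \<le> ?k"
      using \<open>A > 0\<close> by simp
    show "is_curvature G1 (\<lambda>u. ?k * (w u + (if u = a then sum w (verts G2) else 0)))"
      unfolding is_curvature_def
    proof
      fix v assume v: "v \<in> verts G1"
      have "(\<Sum>u\<in>verts G1. gdist G1 v u * (?k * (w u + (if u = a then S2 else 0)))) =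
          ?k * (\<Sum>u\<in>verts G1. gdist G1 v u * w u + (if u = a then gdist G1 v u * S2 else 0))"
        unfolding sum_distrib_left by (intro sum.cong) (auto simp: algebra_simps)
      also have "\<dots> = ?k * ((\<Sum>u\<in>verts G1. gdist G1 v u * w u) + gdist G1 v a * S2)"
        using fin a_in by (simp add: sum.distrib)
      also have "\<dots> = ?k * A"
        using row[OF v] row_a by (intro arg_cong[where f = "(*) ?k"]) simp
      finally show "(\<Sum>u\<in>verts G1. gdist G1 v u *
          (?k * (w u + (if u = a then sum w (verts G2) else 0)))) = real (card (verts G1))"
        unfolding S2_def using \<open>A > 0\<close> by simp
    qed
  qed
qed

lemma nonneg_curvature_left:
  assumes "has_nonneg_curvature G" "2 \<le> card (verts G1)"
  shows "has_nonneg_curvature G1"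
proof -
  obtain w where w: "is_curvature G w" "\<And>v. v \<in> verts G \<Longrightarrow> 0 \<le> w v"
    using assms(1) by (auto simp: has_nonneg_curvature_def)
  obtain k where k: "0 \<le> k"
    "is_curvature G1 (\<lambda>u. k * (w u + (if u = a then sum w (verts G2) else 0)))"
    using curvature_left[OF w assms(2)] by blast
  have "0 \<le> sum w (verts G2)"
    using w(2) verts_eq by (intro sum_nonneg) auto
  then have "\<forall>u\<in>verts G1. 0 \<le> k * (w u + (if u = a then sum w (verts G2) else 0))"
    using k(1) w(2) verts_eq by auto
  then show ?thesis
    using k(2) unfolding has_nonneg_curvature_def by blast
qed

text \<open>Distances are nonnegative, so a negative constant would give nonpositive row sums,
  whereas each equals the positive number of vertices. This supplies the sign condition of
  \<open>curvature_left\<close>.\<close>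

lemma constant_curvature_nonneg:
  assumes "is_curvature G (\<lambda>_. c)"
  shows "0 \<le> c"
proof (rule ccontr)
  assume "\<not> 0 \<le> c"
  moreover have "a \<in> verts G"
    using a_in verts_eq by blast
  ultimately have "gdist G a u * c \<le> 0" if "u \<in> verts G" for u
    using that strongly_connected_join
    by (intro mult_nonneg_nonpos G.gdist_nonneg) (simp_all add: strongly_connected_def)
  then have "(\<Sum>u\<in>verts G. gdist G a u * c) \<le> 0"
    by (rule sum_nonpos)
  moreover have "0 < real (card (verts G))"
    using \<open>a \<in> verts G\<close> finite_verts by (auto simp: card_gt_0_iff)
  ultimately show False
    using assms \<open>a \<in> verts G\<close> by (simp add: is_curvature_def)
qed

lemma curvature_constant_off_left:
  assumes "has_constant_curvature G" "2 \<le> card (verts G1)"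
  shows "has_curvature_constant_off G1 a"
proof -
  obtain c where c: "is_curvature G (\<lambda>_. c)"
    using assms(1) by (auto simp: has_constant_curvature_def)
  obtain k where k:
    "is_curvature G1 (\<lambda>u. k * (c + (if u = a then sum (\<lambda>_. c) (verts G2) else 0)))"
    (is "is_curvature G1 ?w")
    using curvature_left[OF c constant_curvature_nonneg[OF c] assms(2)] by blast
  have const: "\<forall>v\<in>verts G1 - {a}. ?w v = k * c"
    by simp
  show ?thesis
    unfolding has_curvature_constant_off_def
    by (rule exI[of _ ?w], rule exI[of _ "k * c"]) (rule conjI[OF k const])
qed

end

section \<open>Bridges\<close>

lemma dominates_remove_edge_iff:
  "u \<rightarrow>\<^bsub>remove_edge G a b\<^esub> v \<longleftrightarrow> u \<rightarrow>\<^bsub>G\<^esub> v \<and> {u, v} \<noteq> {a, b}"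
  by (auto simp: arcs_ends_conv remove_edge_def image_iff)

lemma induced_subgraph_dominates_iff:
  assumes "induced_subgraph H G"
  shows "u \<rightarrow>\<^bsub>H\<^esub> v \<longleftrightarrow> u \<rightarrow>\<^bsub>G\<^esub> v \<and> u \<in> verts H \<and> v \<in> verts H"
  using assms
  by (auto simp: induced_subgraph_def subgraph_def compatible_def arcs_ends_conv image_iff)

lemma (in wf_digraph) wf_digraph_remove_edge: "wf_digraph (remove_edge G a b)"
  by unfold_locales (auto simp: remove_edge_def)

text \<open>Deletion depends only on the unordered pair of ends, so opposite arcs disappear
  together.\<close>

lemma (in sym_digraph) sym_digraph_remove_edge: "sym_digraph (remove_edge G a b)"
proof -
  have "symmetric (remove_edge G a b)"
    unfolding symmetric_def
  proof (rule symI)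
    fix u v assume "u \<rightarrow>\<^bsub>remove_edge G a b\<^esub> v"
    then have "u \<rightarrow>\<^bsub>G\<^esub> v" "{v, u} \<noteq> {a, b}"
      by (simp_all add: dominates_remove_edge_iff insert_commute)
    moreover from this have "v \<rightarrow>\<^bsub>G\<^esub> u"
      using sym_arcs by (simp add: arcs_ends_symmetric)
    ultimately show "v \<rightarrow>\<^bsub>remove_edge G a b\<^esub> u"
      by (simp add: dominates_remove_edge_iff)
  qed
  then show ?thesis
    using wf_digraph_remove_edge wf_digraph.sym_digraphI by blast
qed

text \<open>By symmetry, reachability in one direction already is mutual reachability, so a
  component is the set reachable from any of its vertices.\<close>

lemma (in sym_digraph) verts_scc_eq:
  assumes "H \<in> sccs" "u \<in> verts H"
  shows "verts H = {v. u \<rightarrow>\<^sup>* v}"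
proof -
  have "verts H \<in> sccs_verts"
    using assms(1) by (simp add: sccs_verts_conv)
  then have "u \<rightarrow>\<^sup>* v \<longleftrightarrow> v \<in> verts H" for v
    using assms(2) symmetric_reachable[OF sym_arcs, of u v]
    unfolding in_sccs_verts_conv_reachable by blast
  then show ?thesis
    by blast
qed

lemma bridge_join_of_is_bridge:
  fixes G G1 G2 :: "('a, 'b) pre_digraph"
  assumes "graph G" "connected G" "is_bridge G a b"
    and G1: "G1 \<in> pre_digraph.sccs (remove_edge G a b)" "a \<in> verts G1"
    and G2: "G2 \<in> pre_digraph.sccs (remove_edge G a b)" "b \<in> verts G2"
  shows "bridge_join G G1 G2 a b"
proof -
  interpret G: graph G by fact
  define H where "H = remove_edge G a b"
  interpret H: sym_digraph H
    unfolding H_def by (rule G.sym_digraph_remove_edge)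
  have verts_H: "verts H = verts G"
    by (simp add: H_def remove_edge_def)
  have dom_H: "u \<rightarrow>\<^bsub>H\<^esub> v \<longleftrightarrow> u \<rightarrow>\<^bsub>G\<^esub> v \<and> {u, v} \<noteq> {a, b}" for u v
    by (simp add: H_def dominates_remove_edge_iff)
  have "a \<rightarrow>\<^bsub>G\<^esub> b"
    using assms(3) by (simp add: is_bridge_def)
  then have ab: "a \<rightarrow>\<^bsub>G\<^esub> b" "b \<rightarrow>\<^bsub>G\<^esub> a"
    using G.sym_arcs by (simp_all add: arcs_ends_symmetric)
  then have ab_in: "a \<in> verts H" "b \<in> verts H"
    by (auto simp: verts_H dest: G.adj_in_verts)
  have V1: "verts G1 = {v. a \<rightarrow>\<^sup>*\<^bsub>H\<^esub> v}"
    using G1 unfolding H_def[symmetric] by (rule H.verts_scc_eq)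
  have V2: "verts G2 = {v. b \<rightarrow>\<^sup>*\<^bsub>H\<^esub> v}"
    using G2 unfolding H_def[symmetric] by (rule H.verts_scc_eq)
  have induced: "induced_subgraph G1 H" "induced_subgraph G2 H"
    using G1 G2 unfolding H_def by (auto intro: pre_digraph.in_sccs_imp_induced)
  have sc: "strongly_connected G1" "strongly_connected G2"
    using G1 G2 by (auto simp: pre_digraph.sccs_def)
  have sym_reach: "v \<rightarrow>\<^sup>*\<^bsub>H\<^esub> u" if "u \<rightarrow>\<^sup>*\<^bsub>H\<^esub> v" for u v
    using symmetric_reachable[OF H.sym_arcs that] .
  have cover: "a \<rightarrow>\<^sup>*\<^bsub>H\<^esub> v \<or> b \<rightarrow>\<^sup>*\<^bsub>H\<^esub> v" if "v \<in> verts G" for v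
  proof -
    have "strongly_connected G"
      using assms(2) G.sym_arcs by (intro G.symmetric_connected_imp_strongly_connected)
    then have "a \<rightarrow>\<^sup>*\<^bsub>G\<^esub> v"
      using that ab_in verts_H by (simp add: strongly_connected_def)
    then show ?thesis
    proof (induction rule: G.reachable_induct)
      case base
      then show ?case using ab_in by simp
    next
      case (step x y)
      show ?case
      proof (cases "{x, y} = {a, b}")
        case True
        \<comment> \<open>After crossing the deleted edge the walk stands at \<open>a\<close> or
          \<open>b\<close>, from where the count starts afresh with the empty walk.\<close>
        then show ?thesis using ab_in by (auto simp: doubleton_eq_iff)
      next
        case False
        then show ?thesis
          using step dom_H by (metis H.reachable_adj_trans)
      qed
    qed
  qed
  \<comment> \<open>Otherwise \<open>cover\<close> would make every vertex reachable from
    \<open>a\<close> in \<open>H\<close>, contradicting that deleting the bridge disconnects the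
    graph.\<close>
  have not_ab: "\<not> a \<rightarrow>\<^sup>*\<^bsub>H\<^esub> b"
  proof
    assume "a \<rightarrow>\<^sup>*\<^bsub>H\<^esub> b"
    then have from_a: "a \<rightarrow>\<^sup>*\<^bsub>H\<^esub> v" if "v \<in> verts H" for v
      using cover that verts_H by (metis H.reachable_trans)
    have "connected H"
    proof (rule H.connectedI)
      show "verts H \<noteq> {}"
        using ab_in by blast
      show "u \<rightarrow>\<^sup>*\<^bsub>mk_symmetric H\<^esub> v" if "u \<in> verts H" "v \<in> verts H" for u v
        using H.reachable_mk_symmetricI[OF H.reachable_trans[OF sym_reach[OF from_a] from_a]] that .
    qed
    then show False
      using assms(3) by (simp add: is_bridge_def H_def)
  qed
  have disjoint: "verts G1 \<inter> verts G2 = {}"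
  proof -
    have False if "a \<rightarrow>\<^sup>*\<^bsub>H\<^esub> v" "b \<rightarrow>\<^sup>*\<^bsub>H\<^esub> v" for v
      using not_ab H.reachable_trans[OF that(1) sym_reach[OF that(2)]] ..
    then show ?thesis
      unfolding V1 V2 by blast
  qed
  have verts_eq: "verts G = verts G1 \<union> verts G2"
  proof
    show "verts G \<subseteq> verts G1 \<union> verts G2"
      unfolding V1 V2 using cover by blast
    show "verts G1 \<union> verts G2 \<subseteq> verts G"
      using induced by (auto simp: induced_subgraph_def subgraph_def verts_H)
  qed
  \<comment> \<open>No arc of \<open>H\<close> joins the two sides, so the induced subgraphs
    \<open>G1\<close> and \<open>G2\<close> together contain every adjacency of \<open>G\<close>
    except the bridge.\<close>
  have same_side: "u \<in> verts G1 \<and> v \<in> verts G1 \<or> u \<in> verts G2 \<and> v \<in> verts G2"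
    if "u \<rightarrow>\<^bsub>H\<^esub> v" for u v
  proof -
    have "u \<in> verts G"
      using that verts_H H.adj_in_verts(1) by metis
    then show ?thesis
      using cover[of u] H.reachable_adj_trans[OF _ that, of a] H.reachable_adj_trans[OF _ that, of b]
      unfolding V1 V2 by blast
  qed
  show ?thesis
  proof (rule bridge_join.intro)
    show "wf_digraph G1" "wf_digraph G2"
      using induced by (auto simp: induced_subgraph_def subgraph_def)
    show "u \<rightarrow>\<^bsub>G\<^esub> v \<longleftrightarrow>
        u \<rightarrow>\<^bsub>G1\<^esub> v \<or> u \<rightarrow>\<^bsub>G2\<^esub> v \<or> (u, v) = (a, b) \<or> (u, v) = (b, a)" for u v
      unfolding induced_subgraph_dominates_iff[OF induced(1)]
        induced_subgraph_dominates_iff[OF induced(2)]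
      using same_side[of u v] dom_H[of u v] ab by (auto simp: doubleton_eq_iff)
    show "finite (verts G)"
      by simp
  qed (use sc verts_eq disjoint G1 G2 in \<open>auto intro: G.wf_digraph\<close>)
qed

theorem theorem4:
  fixes G G1 G2 :: "('a, 'b) pre_digraph" and a b :: 'a
  assumes "graph G"
    and "connected G"
    and "is_bridge G a b"
    and "G1 \<in> pre_digraph.sccs (remove_edge G a b)" and "a \<in> verts G1"
    and "G2 \<in> pre_digraph.sccs (remove_edge G a b)" and "b \<in> verts G2"
    and "has_nonneg_curvature G"
  shows "(2 \<le> card (verts G1) \<longrightarrow> has_nonneg_curvature G1) \<and>
         (2 \<le> card (verts G2) \<longrightarrow> has_nonneg_curvature G2) \<and>
         (has_constant_curvature G \<longrightarrow>
            (2 \<le> card (verts G1) \<longrightarrow> has_curvature_constant_off G1 a) \<and>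
            (2 \<le> card (verts G2) \<longrightarrow> has_curvature_constant_off G2 b))"
proof -
  interpret left: bridge_join G G1 G2 a b
    using assms by (intro bridge_join_of_is_bridge)
  interpret right: bridge_join G G2 G1 b a
    by (rule left.swap)
  show ?thesis
    using assms(8) left.nonneg_curvature_left right.nonneg_curvature_left
      left.curvature_constant_off_left right.curvature_constant_off_left
    by blast
qed

end
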